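(* For every finite script $S$ and every field $\Bbbk$, $$\mathcal M_S(t)=\mathcal P_{S,\Bbbk}(t)+(1+t)\,\mathcal B_{S,\Bbbk}(t).$$ In particular, $\mathcal M_S(t)-\mathcal P_{S,\Bbbk}(t)$ is divisible by $1+t$, with quotient having nonnegative coefficients.
   Context: A finite script $S$ is used only through its reduced chain complex $C(S)$: a chain complex $0\leftarrow C_0(S)\xleftarrow{\partial_1}C_1(S)\leftarrow\cdots\xleftarrow{\partial_n}C_n(S)\leftarrow 0$ with $C_k(S)$ the free abelian group on the finite set of $k$-cells of $S$ and $\partial_k\partial_{k+1}=0$ (the degree $-1$ "accumulator" module of the script is discarded). For a field $\Bbbk$ put $C(S;\Bbbk)=C(S)\otimes_{\mathbb Z}\Bbbk$, and $c_k=\dim_\Bbbk C_k(S;\Bbbk)$, $\beta_k=\dim_\Bbbk H_k(C(S;\Bbbk))$, $r_k=\operatorname{rank}_\Bbbk\partial_k$ with $r_0=0$. Define $\mathcal M_S(t)=\sum_{k\ge0}c_kt^k$ (cell-count polynomial), $\mathcal P_{S,\Bbbk}(t)=\sum_{k\ge0}\beta_kt^k$ (Poincaré polynomial), $\mathcal B_{S,\Bbbk}(t)=\sum_{k\ge0}r_{k+1}t^k$ (boundary polynomial). *)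

theory Defs
  imports
    "HOL-Algebra.Free_Abelian_Groups"
    "HOL-Algebra.AbelCoset"
    "HOL-Computational_Algebra.Polynomial"
    "HOL-Library.Groups_Big_Fun"
    "Jordan_Normal_Form.Missing_VectorSpace"
begin

text \<open>As in \<^const>\<open>FactGroup\<close>, elements are cosets. For a coset \<open>X = N + x\<close> the set
  \<open>N + a X\<close> is the coset of \<open>a x\<close>; adding \<open>N\<close> matters when \<open>a\<close> acts as zero.
  The fields \<open>mult\<close> and \<open>one\<close> of a module record are meaningless and left undefined.\<close>

definition quotient_module ::
    "('k, 'v, 'm) module_scheme \<Rightarrow> 'v set \<Rightarrow> ('k, 'v set) module"
  where "quotient_module M N =
    \<lparr>carrier = a_rcosets\<^bsub>M\<^esub> N, monoid.mult = undefined, one = undefined,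
     zero = N, add = set_add M,
     smult = (\<lambda>a X. N <+>\<^bsub>M\<^esub> ((\<lambda>x. a \<odot>\<^bsub>M\<^esub> x) ` X))\<rparr>"

text \<open>The abelian group \<open>A\<close> is written multiplicatively (a monoid record), as
  \<^const>\<open>free_Abelian_group\<close> is. The tensor product is the free abelian group on the pairs
  \<open>(x, b)\<close> modulo biadditivity, with scalars acting on the second factor. Compatibility
  with integer multiples, \<open>(n x, b) = (x, n b)\<close>, follows from biadditivity.\<close>

definition pre_tensor ::
    "('a, 'n) monoid_scheme \<Rightarrow> ('k, 'm) ring_scheme \<Rightarrow> ('k, ('a \<times> 'k) \<Rightarrow>\<^sub>0 int) module"
  where "pre_tensor A K =
    \<lparr>carrier = carrier (free_Abelian_group (carrier A \<times> carrier K)),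
     monoid.mult = undefined, one = undefined, zero = 0, add = (+),
     smult = (\<lambda>a. frag_extend (\<lambda>(x, b). frag_of (x, a \<otimes>\<^bsub>K\<^esub> b)))\<rparr>"

definition tensor_relations ::
    "('a, 'n) monoid_scheme \<Rightarrow> ('k, 'm) ring_scheme \<Rightarrow> (('a \<times> 'k) \<Rightarrow>\<^sub>0 int) set"
  where "tensor_relations A K =
    generate (free_Abelian_group (carrier A \<times> carrier K))
      ({frag_of (x \<otimes>\<^bsub>A\<^esub> y, b) - frag_of (x, b) - frag_of (y, b) | x y b.
          x \<in> carrier A \<and> y \<in> carrier A \<and> b \<in> carrier K} \<union>
       {frag_of (x, b \<oplus>\<^bsub>K\<^esub> c) - frag_of (x, b) - frag_of (x, c) | x b c.
          x \<in> carrier A \<and> b \<in> carrier K \<and> c \<in> carrier K})"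

definition tensor ::
    "('a, 'n) monoid_scheme \<Rightarrow> ('k, 'm) ring_scheme \<Rightarrow> ('k, (('a \<times> 'k) \<Rightarrow>\<^sub>0 int) set) module"
  where "tensor A K = quotient_module (pre_tensor A K) (tensor_relations A K)"

text \<open>\<open>tensor_map B K f\<close> is \<open>f \<otimes> id\<close>, for \<open>f\<close> with codomain \<open>B\<close>.\<close>

definition tensor_map ::
    "('b, 'n) monoid_scheme \<Rightarrow> ('k, 'm) ring_scheme \<Rightarrow> ('a \<Rightarrow> 'b) \<Rightarrow>
     (('a \<times> 'k) \<Rightarrow>\<^sub>0 int) set \<Rightarrow> (('b \<times> 'k) \<Rightarrow>\<^sub>0 int) set"
  where "tensor_map B K f X =
    tensor_relations B K <+>\<^bsub>pre_tensor B K\<^esub>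
      (frag_extend (\<lambda>(x, b). frag_of (f x, b)) ` X)"

text \<open>\<open>cells k\<close> is the set of \<open>k\<close>-cells, and \<open>bd k\<close> for \<open>k \<ge> 1\<close> is the boundary map
  from degree \<open>k\<close> to degree \<open>k - 1\<close>. The value \<open>bd 0\<close> is never used: there is nothing
  below degree 0.\<close>

abbreviation chain_group :: "(nat \<Rightarrow> 'c set) \<Rightarrow> nat \<Rightarrow> ('c \<Rightarrow>\<^sub>0 int) monoid"
  where "chain_group cells k \<equiv> free_Abelian_group (cells k)"

locale finite_script_complex =
  fixes cells :: "nat \<Rightarrow> 'c set"
    and bd :: "nat \<Rightarrow> ('c \<Rightarrow>\<^sub>0 int) \<Rightarrow> ('c \<Rightarrow>\<^sub>0 int)"
  assumes finite_cells: "finite (cells k)"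
    and bounded_dimension: "\<exists>n. \<forall>k>n. cells k = {}"
    and bd_hom: "bd (Suc k) \<in> hom (chain_group cells (Suc k)) (chain_group cells k)"
    and bd_bd: "x \<in> carrier (chain_group cells (Suc (Suc k))) \<Longrightarrow>
                  bd (Suc k) (bd (Suc (Suc k)) x) = 0"

definition chain_space ::
    "(nat \<Rightarrow> 'c set) \<Rightarrow> ('k, 'm) ring_scheme \<Rightarrow> nat \<Rightarrow>
     ('k, ((('c \<Rightarrow>\<^sub>0 int) \<times> 'k) \<Rightarrow>\<^sub>0 int) set) module"
  where "chain_space cells K k = tensor (chain_group cells k) K"

text \<open>\<open>bd_map cells bd K k\<close> is the boundary map of the base-changed complex from degree
  \<open>k + 1\<close> to degree \<open>k\<close>.\<close>

definition bd_map ::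
    "(nat \<Rightarrow> 'c set) \<Rightarrow> (nat \<Rightarrow> ('c \<Rightarrow>\<^sub>0 int) \<Rightarrow> ('c \<Rightarrow>\<^sub>0 int)) \<Rightarrow> ('k, 'm) ring_scheme \<Rightarrow> nat \<Rightarrow>
     ((('c \<Rightarrow>\<^sub>0 int) \<times> 'k) \<Rightarrow>\<^sub>0 int) set \<Rightarrow> ((('c \<Rightarrow>\<^sub>0 int) \<times> 'k) \<Rightarrow>\<^sub>0 int) set"
  where "bd_map cells bd K k = tensor_map (chain_group cells k) K (bd (Suc k))"

fun cycles ::
    "(nat \<Rightarrow> 'c set) \<Rightarrow> (nat \<Rightarrow> ('c \<Rightarrow>\<^sub>0 int) \<Rightarrow> ('c \<Rightarrow>\<^sub>0 int)) \<Rightarrow> ('k, 'm) ring_scheme \<Rightarrow> nat \<Rightarrow>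
     ((('c \<Rightarrow>\<^sub>0 int) \<times> 'k) \<Rightarrow>\<^sub>0 int) set set"
  where
    "cycles cells bd K 0 = carrier (chain_space cells K 0)"
  | "cycles cells bd K (Suc k) =
       a_kernel (chain_space cells K (Suc k)) (chain_space cells K k) (bd_map cells bd K k)"

definition boundaries ::
    "(nat \<Rightarrow> 'c set) \<Rightarrow> (nat \<Rightarrow> ('c \<Rightarrow>\<^sub>0 int) \<Rightarrow> ('c \<Rightarrow>\<^sub>0 int)) \<Rightarrow> ('k, 'm) ring_scheme \<Rightarrow> nat \<Rightarrow>
     ((('c \<Rightarrow>\<^sub>0 int) \<times> 'k) \<Rightarrow>\<^sub>0 int) set set"
  where "boundaries cells bd K k = bd_map cells bd K k ` carrier (chain_space cells K (Suc k))"

definition homology ::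
    "(nat \<Rightarrow> 'c set) \<Rightarrow> (nat \<Rightarrow> ('c \<Rightarrow>\<^sub>0 int) \<Rightarrow> ('c \<Rightarrow>\<^sub>0 int)) \<Rightarrow> ('k, 'm) ring_scheme \<Rightarrow> nat \<Rightarrow>
     ('k, ((('c \<Rightarrow>\<^sub>0 int) \<times> 'k) \<Rightarrow>\<^sub>0 int) set set) module"
  where "homology cells bd K k =
    quotient_module (chain_space cells K k\<lparr>carrier := cycles cells bd K k\<rparr>)
      (boundaries cells bd K k)"

definition chain_dim :: "(nat \<Rightarrow> 'c set) \<Rightarrow> ('k, 'm) ring_scheme \<Rightarrow> nat \<Rightarrow> nat"
  where "chain_dim cells K k = vectorspace.dim K (chain_space cells K k)"

definition betti ::
    "(nat \<Rightarrow> 'c set) \<Rightarrow> (nat \<Rightarrow> ('c \<Rightarrow>\<^sub>0 int) \<Rightarrow> ('c \<Rightarrow>\<^sub>0 int)) \<Rightarrow> ('k, 'm) ring_scheme \<Rightarrow> nat \<Rightarrow> nat"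
  where "betti cells bd K k = vectorspace.dim K (homology cells bd K k)"

text \<open>\<open>bd_rank cells bd K k\<close> is the rank of the boundary map leaving degree \<open>k\<close>.\<close>

fun bd_rank ::
    "(nat \<Rightarrow> 'c set) \<Rightarrow> (nat \<Rightarrow> ('c \<Rightarrow>\<^sub>0 int) \<Rightarrow> ('c \<Rightarrow>\<^sub>0 int)) \<Rightarrow> ('k, 'm) ring_scheme \<Rightarrow> nat \<Rightarrow> nat"
  where
    "bd_rank cells bd K 0 = 0"
  | "bd_rank cells bd K (Suc k) =
       vectorspace.dim K (chain_space cells K k\<lparr>carrier := boundaries cells bd K k\<rparr>)"

text \<open>\<^const>\<open>Sum_any\<close> sums over all \<open>k\<close> with nonzero summand (and would be 0 if there were
  infinitely many; by \<open>bounded_dimension\<close> there are only finitely many).\<close>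

definition cell_poly :: "(nat \<Rightarrow> 'c set) \<Rightarrow> ('k, 'm) ring_scheme \<Rightarrow> int poly"
  where "cell_poly cells K = Sum_any (\<lambda>k. monom (int (chain_dim cells K k)) k)"

definition poincare_poly ::
    "(nat \<Rightarrow> 'c set) \<Rightarrow> (nat \<Rightarrow> ('c \<Rightarrow>\<^sub>0 int) \<Rightarrow> ('c \<Rightarrow>\<^sub>0 int)) \<Rightarrow> ('k, 'm) ring_scheme \<Rightarrow> int poly"
  where "poincare_poly cells bd K = Sum_any (\<lambda>k. monom (int (betti cells bd K k)) k)"

definition boundary_poly ::
    "(nat \<Rightarrow> 'c set) \<Rightarrow> (nat \<Rightarrow> ('c \<Rightarrow>\<^sub>0 int) \<Rightarrow> ('c \<Rightarrow>\<^sub>0 int)) \<Rightarrow> ('k, 'm) ring_scheme \<Rightarrow> int poly"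
  where "boundary_poly cells bd K = Sum_any (\<lambda>k. monom (int (bd_rank cells bd K (Suc k))) k)"

end

theory Submission
  imports Defs
begin

text \<open>The identity is rank-nullity in every degree, read as an identity of generating functions.
  Write \<open>c\<^sub>k\<close>, \<open>\<beta>\<^sub>k\<close>, \<open>r\<^sub>k\<close> for the dimension of the chain space, the dimension of homology and
  the rank of the boundary map leaving degree \<open>k\<close>. The kernel of that map is the space of cycles
  \<open>Z\<^sub>k\<close>, so \<open>c\<^sub>k = dim Z\<^sub>k + r\<^sub>k\<close>; and homology is \<open>Z\<^sub>k\<close> modulo a subspace of dimension
  \<open>r\<^bsub>k+1\<^esub>\<close>, so \<open>dim Z\<^sub>k = \<beta>\<^sub>k + r\<^bsub>k+1\<^esub>\<close>. Hence \<open>c\<^sub>k - \<beta>\<^sub>k = r\<^bsub>k+1\<^esub> + r\<^sub>k\<close>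
  (\<open>chain_dim_eq\<close>), which is the coefficient of \<open>t\<^sup>k\<close> in \<open>(1 + t) \<Sum> r\<^bsub>k+1\<^esub> t\<^sup>k\<close> because
  \<open>r\<^sub>0 = 0\<close>. The quotient by \<open>1 + t\<close> has the ranks as coefficients, so it is nonnegative.

  The remaining work is to see that the explicitly constructed tensor products and quotients are
  finite-dimensional vector spaces and that the boundary maps are linear. A quotient of a group
  with a scalar action is a module if the module laws hold modulo the subgroup
  (\<open>quotient_is_module\<close>), and a map that respects the subgroups induces a linear map
  (\<open>induced_map_is_mod_hom\<close>); the tensor relations supply the one law, \<open>(a + b) x = a x + b x\<close>,
  that fails in the free abelian group on pairs (\<open>tensor_module_modulo\<close>). Tensoring a free group on a finite set
  \<open>S\<close> with the field yields a space spanned by \<open>card S\<close> vectors (\<open>tensor_free_spanned\<close>).\<close>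

section \<open>Quotients by a subgroup and the maps they induce\<close>

text \<open>Both actions on cosets used below, by scalars and by induced maps, have the shape
  \<open>X \<mapsto> N' + f X\<close> with \<open>f\<close> additive and \<open>f N \<subseteq> N'\<close>. Such a map sends the coset of \<open>x\<close> to the
  coset of \<open>f x\<close>, since \<open>n' + f (n + x) = (n' + f n) + f x\<close>.\<close>

lemma coset_image_eq:
  fixes M :: "('a, 'm) ring_scheme" and M' :: "('b, 'n) ring_scheme"
  assumes N: "abelian_subgroup N M" and N': "abelian_subgroup N' M'"
    and f: "f \<in> carrier M \<rightarrow> carrier M'"
    and add: "\<And>x y. x \<in> carrier M \<Longrightarrow> y \<in> carrier M \<Longrightarrow> f (x \<oplus>\<^bsub>M\<^esub> y) = f x \<oplus>\<^bsub>M'\<^esub> f y"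
    and img: "f ` N \<subseteq> N'" and x: "x \<in> carrier M"
  shows "N' <+>\<^bsub>M'\<^esub> f ` (N +>\<^bsub>M\<^esub> x) = N' +>\<^bsub>M'\<^esub> f x"
proof -
  interpret N: abelian_subgroup N M by fact
  interpret N': abelian_subgroup N' M' by fact
  have fx: "f x \<in> carrier M'" using f x by auto
  show ?thesis
  proof (intro equalityI subsetI)
    fix y assume "y \<in> N' <+>\<^bsub>M'\<^esub> f ` (N +>\<^bsub>M\<^esub> x)"
    then obtain n' n where n: "n' \<in> N'" "n \<in> N" "y = n' \<oplus>\<^bsub>M'\<^esub> f (n \<oplus>\<^bsub>M\<^esub> x)"
      by (auto simp: set_add_def' a_r_coset_def')
    have "f n \<in> N'" using img n by auto
    moreover have "y = (n' \<oplus>\<^bsub>M'\<^esub> f n) \<oplus>\<^bsub>M'\<^esub> f x"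
      using n x fx \<open>f n \<in> N'\<close> by (simp add: add N'.a_assoc)
    ultimately show "y \<in> N' +>\<^bsub>M'\<^esub> f x"
      using n by (auto simp: a_r_coset_def')
  next
    fix y assume "y \<in> N' +>\<^bsub>M'\<^esub> f x"
    then obtain n' where n: "n' \<in> N'" "y = n' \<oplus>\<^bsub>M'\<^esub> f x"
      by (auto simp: a_r_coset_def')
    have "x \<in> N +>\<^bsub>M\<^esub> x" using x by (rule N.a_rcos_self)
    then show "y \<in> N' <+>\<^bsub>M'\<^esub> f ` (N +>\<^bsub>M\<^esub> x)"
      using n by (auto simp: set_add_def')
  qed
qed

text \<open>Scalars act on \<open>M\<close> by additive maps that preserve \<open>N\<close>, but the other module laws are required
  only up to elements of \<open>N\<close>. This covers two situations: a module with a submodule, and the free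
  abelian group on pairs, where \<open>(a + b) x = a x + b x\<close> holds only modulo the tensor relations.\<close>

locale module_modulo = R?: cring K + M?: abelian_subgroup N M
  for K :: "('k, 'r) ring_scheme" and N :: "'v set" and M :: "('k, 'v, 'm) module_scheme" +
  assumes scale_closed: "a \<in> carrier K \<Longrightarrow> x \<in> carrier M \<Longrightarrow> a \<odot>\<^bsub>M\<^esub> x \<in> carrier M"
    and scale_add: "a \<in> carrier K \<Longrightarrow> x \<in> carrier M \<Longrightarrow> y \<in> carrier M \<Longrightarrow>
      a \<odot>\<^bsub>M\<^esub> (x \<oplus>\<^bsub>M\<^esub> y) = a \<odot>\<^bsub>M\<^esub> x \<oplus>\<^bsub>M\<^esub> a \<odot>\<^bsub>M\<^esub> y"
    and scale_mem: "a \<in> carrier K \<Longrightarrow> x \<in> N \<Longrightarrow> a \<odot>\<^bsub>M\<^esub> x \<in> N"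
    and add_scale_cong: "a \<in> carrier K \<Longrightarrow> b \<in> carrier K \<Longrightarrow> x \<in> carrier M \<Longrightarrow>
      (a \<oplus>\<^bsub>K\<^esub> b) \<odot>\<^bsub>M\<^esub> x \<in> N +>\<^bsub>M\<^esub> (a \<odot>\<^bsub>M\<^esub> x \<oplus>\<^bsub>M\<^esub> b \<odot>\<^bsub>M\<^esub> x)"
    and mult_scale_cong: "a \<in> carrier K \<Longrightarrow> b \<in> carrier K \<Longrightarrow> x \<in> carrier M \<Longrightarrow>
      (a \<otimes>\<^bsub>K\<^esub> b) \<odot>\<^bsub>M\<^esub> x \<in> N +>\<^bsub>M\<^esub> (a \<odot>\<^bsub>M\<^esub> (b \<odot>\<^bsub>M\<^esub> x))"
    and one_scale_cong: "x \<in> carrier M \<Longrightarrow> \<one>\<^bsub>K\<^esub> \<odot>\<^bsub>M\<^esub> x \<in> N +>\<^bsub>M\<^esub> x"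
begin

lemma quotient_carrier: "carrier (quotient_module M N) = (\<lambda>x. N +>\<^bsub>M\<^esub> x) ` carrier M"
  by (auto simp: quotient_module_def A_RCOSETS_def')

lemma quotient_zero: "\<zero>\<^bsub>quotient_module M N\<^esub> = N"
  by (simp add: quotient_module_def)

lemma quotient_add:
  assumes "x \<in> carrier M" "y \<in> carrier M"
  shows "(N +>\<^bsub>M\<^esub> x) \<oplus>\<^bsub>quotient_module M N\<^esub> (N +>\<^bsub>M\<^esub> y) = N +>\<^bsub>M\<^esub> (x \<oplus>\<^bsub>M\<^esub> y)"
  using a_rcos_sum[OF assms] by (simp add: quotient_module_def)

lemma quotient_smult:
  assumes a: "a \<in> carrier K" and x: "x \<in> carrier M"
  shows "a \<odot>\<^bsub>quotient_module M N\<^esub> (N +>\<^bsub>M\<^esub> x) = N +>\<^bsub>M\<^esub> (a \<odot>\<^bsub>M\<^esub> x)"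
  using coset_image_eq[OF is_abelian_subgroup is_abelian_subgroup, of "\<lambda>x. a \<odot>\<^bsub>M\<^esub> x" x] a x
  by (simp add: quotient_module_def scale_closed scale_add scale_mem image_subset_iff)

lemmas quotient_simps = quotient_carrier quotient_zero quotient_add quotient_smult

lemma zero_coset: "N +>\<^bsub>M\<^esub> \<zero>\<^bsub>M\<^esub> = N"
  using a_subset by simp

text \<open>Each law is checked on representatives: it holds for them up to an element of \<open>N\<close>, which
  is the same as equality of the cosets.\<close>

lemma quotient_is_module: "module K (quotient_module M N)"
proof (rule moduleI)
  show "cring K" by (rule R.is_cring)
  have Q: "\<exists>x\<in>carrier M. X = N +>\<^bsub>M\<^esub> x" if "X \<in> carrier (quotient_module M N)" for X
    using that by (auto simp: quotient_carrier)
  show "abelian_group (quotient_module M N)"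
  proof (rule abelian_groupI)
    fix X Y assume XY: "X \<in> carrier (quotient_module M N)" "Y \<in> carrier (quotient_module M N)"
    then obtain x y where xy: "x \<in> carrier M" "y \<in> carrier M" "X = N +>\<^bsub>M\<^esub> x" "Y = N +>\<^bsub>M\<^esub> y"
      using Q by metis
    then show "X \<oplus>\<^bsub>quotient_module M N\<^esub> Y \<in> carrier (quotient_module M N)"
      by (auto simp: quotient_simps)
    show "X \<oplus>\<^bsub>quotient_module M N\<^esub> Y = Y \<oplus>\<^bsub>quotient_module M N\<^esub> X"
      using xy by (simp add: quotient_simps M.a_comm)
    fix Z assume "Z \<in> carrier (quotient_module M N)"
    then obtain z where "z \<in> carrier M" "Z = N +>\<^bsub>M\<^esub> z"
      using Q by metis
    with xy show "X \<oplus>\<^bsub>quotient_module M N\<^esub> Y \<oplus>\<^bsub>quotient_module M N\<^esub> Z =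
        X \<oplus>\<^bsub>quotient_module M N\<^esub> (Y \<oplus>\<^bsub>quotient_module M N\<^esub> Z)"
      by (simp add: quotient_simps M.a_assoc)
  next
    show "\<zero>\<^bsub>quotient_module M N\<^esub> \<in> carrier (quotient_module M N)"
      using zero_coset by (force simp: quotient_simps)
  next
    fix X assume "X \<in> carrier (quotient_module M N)"
    then obtain x where x: "x \<in> carrier M" "X = N +>\<^bsub>M\<^esub> x"
      using Q by metis
    show "\<zero>\<^bsub>quotient_module M N\<^esub> \<oplus>\<^bsub>quotient_module M N\<^esub> X = X"
      using quotient_add[of "\<zero>\<^bsub>M\<^esub>" x] x by (simp add: zero_coset quotient_zero del: M.a_coset_add_zero)
    show "\<exists>Y\<in>carrier (quotient_module M N).
        Y \<oplus>\<^bsub>quotient_module M N\<^esub> X = \<zero>\<^bsub>quotient_module M N\<^esub>"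
      using x by (intro bexI[of _ "N +>\<^bsub>M\<^esub> (\<ominus>\<^bsub>M\<^esub> x)"])
        (auto simp: quotient_simps M.l_neg zero_coset simp del: M.a_coset_add_zero)
  qed
next
  fix a X assume a: "a \<in> carrier K" and "X \<in> carrier (quotient_module M N)"
  then obtain x where x: "x \<in> carrier M" "X = N +>\<^bsub>M\<^esub> x"
    by (auto simp: quotient_carrier)
  show "a \<odot>\<^bsub>quotient_module M N\<^esub> X \<in> carrier (quotient_module M N)"
    using a x by (auto simp: quotient_simps scale_closed)
next
  fix a b X assume ab: "a \<in> carrier K" "b \<in> carrier K" and "X \<in> carrier (quotient_module M N)"
  then obtain x where x: "x \<in> carrier M" "X = N +>\<^bsub>M\<^esub> x"
    by (auto simp: quotient_carrier)
  show "(a \<oplus>\<^bsub>K\<^esub> b) \<odot>\<^bsub>quotient_module M N\<^esub> X =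
      a \<odot>\<^bsub>quotient_module M N\<^esub> X \<oplus>\<^bsub>quotient_module M N\<^esub> b \<odot>\<^bsub>quotient_module M N\<^esub> X"
    using ab x a_repr_independence'[OF add_scale_cong[OF ab x(1)]]
    by (simp add: quotient_simps scale_closed)
  show "(a \<otimes>\<^bsub>K\<^esub> b) \<odot>\<^bsub>quotient_module M N\<^esub> X =
      a \<odot>\<^bsub>quotient_module M N\<^esub> (b \<odot>\<^bsub>quotient_module M N\<^esub> X)"
    using ab x a_repr_independence'[OF mult_scale_cong[OF ab x(1)]]
    by (simp add: quotient_simps scale_closed)
next
  fix a X Y assume a: "a \<in> carrier K"
    and "X \<in> carrier (quotient_module M N)" "Y \<in> carrier (quotient_module M N)"
  then obtain x y where xy: "x \<in> carrier M" "y \<in> carrier M" "X = N +>\<^bsub>M\<^esub> x" "Y = N +>\<^bsub>M\<^esub> y"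
    by (auto simp: quotient_carrier)
  show "a \<odot>\<^bsub>quotient_module M N\<^esub> (X \<oplus>\<^bsub>quotient_module M N\<^esub> Y) =
      a \<odot>\<^bsub>quotient_module M N\<^esub> X \<oplus>\<^bsub>quotient_module M N\<^esub> a \<odot>\<^bsub>quotient_module M N\<^esub> Y"
    using a xy by (simp add: quotient_simps scale_closed scale_add)
next
  fix X assume "X \<in> carrier (quotient_module M N)"
  then obtain x where x: "x \<in> carrier M" "X = N +>\<^bsub>M\<^esub> x"
    by (auto simp: quotient_carrier)
  show "\<one>\<^bsub>K\<^esub> \<odot>\<^bsub>quotient_module M N\<^esub> X = X"
    using x by (simp add: quotient_smult a_repr_independence'[OF one_scale_cong[OF x(1)], symmetric])
qed

end

lemma induced_map_is_mod_hom:
  assumes MN: "module_modulo K N M" and MN': "module_modulo K N' M'"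
    and f: "f \<in> carrier M \<rightarrow> carrier M'"
    and add: "\<And>x y. x \<in> carrier M \<Longrightarrow> y \<in> carrier M \<Longrightarrow> f (x \<oplus>\<^bsub>M\<^esub> y) = f x \<oplus>\<^bsub>M'\<^esub> f y"
    and scale: "\<And>a x. a \<in> carrier K \<Longrightarrow> x \<in> carrier M \<Longrightarrow> f (a \<odot>\<^bsub>M\<^esub> x) = a \<odot>\<^bsub>M'\<^esub> f x"
    and img: "f ` N \<subseteq> N'"
  shows "mod_hom K (quotient_module M N) (quotient_module M' N') (\<lambda>X. N' <+>\<^bsub>M'\<^esub> f ` X)"
proof -
  interpret MN: module_modulo K N M by fact
  interpret MN': module_modulo K N' M' by fact
  have *: "N' <+>\<^bsub>M'\<^esub> f ` (N +>\<^bsub>M\<^esub> x) = N' +>\<^bsub>M'\<^esub> f x" if "x \<in> carrier M" for x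
    using coset_image_eq[OF MN.is_abelian_subgroup MN'.is_abelian_subgroup f add img that] by simp
  show ?thesis
    unfolding mod_hom_def mod_hom_axioms_def module_hom_def
    using MN.quotient_is_module MN'.quotient_is_module f
    by (auto simp: MN.quotient_simps MN'.quotient_simps * add scale MN.scale_closed Pi_iff)
qed

lemma module_modulo_submodule:
  assumes "submodule K N M"
  shows "module_modulo K N M"
proof -
  interpret N: submodule K N M by fact
  interpret M: module K M by (rule N.module)
  have "additive_subgroup N M"
  proof (rule additive_subgroup.intro, rule subgroup.intro)
    fix x assume x: "x \<in> N"
    then have "inv\<^bsub>add_monoid M\<^esub> x = (\<ominus>\<^bsub>K\<^esub> \<one>\<^bsub>K\<^esub>) \<odot>\<^bsub>M\<^esub> x"
      using M.smult_minus_1 N.subset by (auto simp: a_inv_def)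
    then show "inv\<^bsub>add_monoid M\<^esub> x \<in> N" using x by simp
  qed (use N.subset in auto)
  then interpret abelian_subgroup N M
    by (rule abelian_subgroupI3) (rule M.M.abelian_group_axioms)
  have self: "x \<in> N +>\<^bsub>M\<^esub> x" if "x \<in> carrier M" for x
    using that by (rule a_rcos_self)
  show ?thesis
    by unfold_locales (auto simp: M.smult_l_distr M.smult_r_distr M.smult_assoc1 self)
qed

lemma coset_map_is_mod_hom:
  assumes "submodule K N M"
  shows "mod_hom K M (quotient_module M N) (\<lambda>x. N +>\<^bsub>M\<^esub> x)"
proof -
  interpret MN: module_modulo K N M
    using assms by (rule module_modulo_submodule)
  show ?thesis
    unfolding mod_hom_def mod_hom_axioms_def module_hom_def
    using MN.quotient_is_module assms
    by (auto simp: MN.quotient_simps submodule_def)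
qed

section \<open>Dimensions of subspaces and quotients\<close>

lemma vectorspace_if_module: "field K \<Longrightarrow> module K V \<Longrightarrow> vectorspace K V"
  by (simp add: vectorspace_def module_def)

text \<open>Independent subsets of a subspace are independent in the whole space, so their size is
  bounded by its dimension; a maximal one is a finite basis of the subspace.\<close>

lemma (in vectorspace) subspace_fin_dim:
  assumes "fin_dim" and W: "subspace K W V"
  shows "vectorspace.fin_dim K (vs W)"
proof -
  interpret W: vectorspace K "vs W" using W by (rule subspace_is_vs)
  have sub: "submodule K W V" using W by simp
  have WV: "W \<subseteq> carrier V" using sub by (rule submodule.subset)
  define P where "P A \<longleftrightarrow> A \<subseteq> W \<and> W.lin_indpt A" for A
  have bound: "finite A \<and> card A \<le> dim" if "P A" for A
    using that li_le_dim[OF assms(1), of A] span_li_not_depend(2)[of A W] sub WV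
    by (auto simp: P_def)
  have "W.lin_indpt {}" by (auto simp: W.lin_dep_def)
  then have "P {}" by (simp add: P_def)
  then obtain A where A: "finite A" "maximal A P"
    using maximal_exists[of P dim "{}"] bound by blast
  then have "W.basis A"
    by (intro W.max_li_is_basis) (simp add: P_def[abs_def])
  with A show ?thesis
    by (auto simp: W.fin_dim_def W.basis_def)
qed

text \<open>Rank-nullity for the projection onto the quotient, whose kernel is \<open>N\<close>.\<close>

lemma (in vectorspace) dim_quotient:
  assumes "fin_dim" and N: "subspace K N V"
  shows "dim = vectorspace.dim K (vs N) + vectorspace.dim K (quotient_module V N)"
proof -
  have sub: "submodule K N V" using N by simp
  interpret MN: module_modulo K N V
    using sub by (rule module_modulo_submodule)
  interpret p: mod_hom K V "quotient_module V N" "\<lambda>x. N +>\<^bsub>V\<^esub> x"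
    using sub by (rule coset_map_is_mod_hom)
  have Q: "vectorspace K (quotient_module V N)"
    by (rule vectorspace_if_module[OF field_axioms MN.quotient_is_module])
  interpret L: linear_map K V "quotient_module V N" "\<lambda>x. N +>\<^bsub>V\<^esub> x"
    unfolding linear_map_def using Q vectorspace_axioms p.mod_hom_axioms by blast
  have ker: "L.kerT = N"
  proof -
    have "N +>\<^bsub>V\<^esub> x = N \<longleftrightarrow> x \<in> N" if "x \<in> carrier V" for x
      using that MN.a_rcos_self MN.a_rcos_const by metis
    then show ?thesis
      using submodule.subset[OF sub] by (auto simp: p.ker_def MN.quotient_zero)
  qed
  have im: "L.imT = carrier (quotient_module V N)"
    by (simp add: p.im_def MN.quotient_carrier)
  show "dim = vectorspace.dim K (vs N) + vectorspace.dim K (quotient_module V N)"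
    using L.rank_nullity[OF assms(1)] unfolding ker im by simp
qed

section \<open>Tensor products with a ring of scalars\<close>

lemma keys_frag_extend_subset:
  "(\<And>p. p \<in> Poly_Mapping.keys x \<Longrightarrow> Poly_Mapping.keys (u p) \<subseteq> T) \<Longrightarrow>
    Poly_Mapping.keys (frag_extend u x) \<subseteq> T"
  using keys_frag_extend[of u x] by blast

text \<open>The locale fixes the data of a tensor product \<open>A \<otimes> K\<close>. Inside it, \<open>P\<close> is the free abelian
  group on pairs with its scalar action and \<open>R\<close> is the subgroup of relations; \<open>F\<close> is \<open>P\<close> written
  as a multiplicative group, which is the form in which \<open>R\<close> is generated.\<close>

locale base_change = A?: group A + K?: cring K
  for A :: "('a, 'n) monoid_scheme" and K :: "('k, 'm) ring_scheme"
begin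

abbreviation F where "F \<equiv> free_Abelian_group (carrier A \<times> carrier K)"
abbreviation P where "P \<equiv> pre_tensor A K"
abbreviation R where "R \<equiv> tensor_relations A K"

definition relators where
  "relators = {frag_of (x \<otimes>\<^bsub>A\<^esub> y, b) - frag_of (x, b) - frag_of (y, b) | x y b.
          x \<in> carrier A \<and> y \<in> carrier A \<and> b \<in> carrier K} \<union>
       {frag_of (x, b \<oplus>\<^bsub>K\<^esub> c) - frag_of (x, b) - frag_of (x, c) | x b c.
          x \<in> carrier A \<and> b \<in> carrier K \<and> c \<in> carrier K}"

lemma relators_subset: "relators \<subseteq> carrier F"
  unfolding relators_def by (auto simp: keys_frag_of dest!: subsetD[OF keys_diff])

lemma relations_eq: "R = generate F relators"
  by (simp add: tensor_relations_def relators_def)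

lemma relations_subgroup: "subgroup R F"
  unfolding relations_eq
  by (rule group.generate_is_subgroup[OF group_free_Abelian_group relators_subset])

lemma relations_subset: "x \<in> R \<Longrightarrow> Poly_Mapping.keys x \<subseteq> carrier A \<times> carrier K"
  using subgroup.subset[OF relations_subgroup] by (metis carrier_free_Abelian_group_iff subsetD)

lemma relations_zero: "0 \<in> R"
  using subgroup.one_closed[OF relations_subgroup] by simp

lemma relations_add: "x \<in> R \<Longrightarrow> y \<in> R \<Longrightarrow> x + y \<in> R"
  using subgroup.m_closed[OF relations_subgroup, of x y] by simp

lemma relations_minus: "x \<in> R \<Longrightarrow> - x \<in> R"
  using subgroup.m_inv_closed[OF relations_subgroup, of x] relations_subset[of x] by simp

lemma relations_diff: "x \<in> R \<Longrightarrow> y \<in> R \<Longrightarrow> x - y \<in> R"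
  using relations_add[of x "- y"] relations_minus[of y] by simp

lemma relations_left:
  assumes "x \<in> carrier A" "y \<in> carrier A" "b \<in> carrier K"
  shows "frag_of (x \<otimes>\<^bsub>A\<^esub> y, b) - frag_of (x, b) - frag_of (y, b) \<in> R"
  unfolding relations_eq using assms by (intro generate.incl) (auto simp: relators_def)

lemma relations_right:
  assumes "x \<in> carrier A" "b \<in> carrier K" "c \<in> carrier K"
  shows "frag_of (x, b \<oplus>\<^bsub>K\<^esub> c) - frag_of (x, b) - frag_of (x, c) \<in> R"
  unfolding relations_eq using assms by (intro generate.incl) (auto simp: relators_def)

text \<open>From \<open>1 \<otimes> b = (1 \<cdot> 1) \<otimes> b = 1 \<otimes> b + 1 \<otimes> b\<close>, where \<open>1\<close> is the neutral element of the
  multiplicatively written group \<open>A\<close>; so this is the rule \<open>0 \<otimes> b = 0\<close>.\<close>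

lemma relations_one: "b \<in> carrier K \<Longrightarrow> frag_of (\<one>\<^bsub>A\<^esub>, b) \<in> R"
  using relations_minus[OF relations_left[of "\<one>\<^bsub>A\<^esub>" "\<one>\<^bsub>A\<^esub>" b]] by simp

lemma pre_tensor_simps:
  "carrier P = {x. Poly_Mapping.keys x \<subseteq> carrier A \<times> carrier K}"
  "\<zero>\<^bsub>P\<^esub> = 0" "x \<oplus>\<^bsub>P\<^esub> y = x + y"
  "a \<odot>\<^bsub>P\<^esub> x = frag_extend (\<lambda>(x, b). frag_of (x, a \<otimes>\<^bsub>K\<^esub> b)) x"
  by (auto simp: pre_tensor_def free_Abelian_group_def)

lemma pre_tensor_group: "abelian_group P"
proof (rule abelian_groupI)
  fix x assume "x \<in> carrier P"
  then show "\<exists>y\<in>carrier P. y \<oplus>\<^bsub>P\<^esub> x = \<zero>\<^bsub>P\<^esub>"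
    by (intro bexI[of _ "- x"]) (auto simp: pre_tensor_simps)
qed (auto simp: pre_tensor_simps algebra_simps dest!: subsetD[OF keys_add])

lemma pre_tensor_minus: "x \<in> carrier P \<Longrightarrow> \<ominus>\<^bsub>P\<^esub> x = - x"
  by (rule abelian_group.minus_equality[OF pre_tensor_group]) (auto simp: pre_tensor_simps)

lemma relations_abelian_subgroup: "abelian_subgroup R P"
proof (rule abelian_subgroupI3)
  have "inv\<^bsub>add_monoid P\<^esub> x \<in> R" if "x \<in> R" for x
    using that relations_subset[OF that] pre_tensor_minus[of x, unfolded a_inv_def]
    by (simp only: relations_minus pre_tensor_simps(1) mem_Collect_eq)
  then show "additive_subgroup R P"
    using relations_subset
    by (intro additive_subgroup.intro subgroup.intro)
      (simp_all add: subset_iff pre_tensor_simps(1-3) relations_zero relations_add)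
qed (rule pre_tensor_group)

lemma coset_iff:
  assumes "x \<in> carrier P" "y \<in> carrier P"
  shows "x \<in> R +>\<^bsub>P\<^esub> y \<longleftrightarrow> x - y \<in> R"
  using abelian_subgroup.a_rcos_module[OF relations_abelian_subgroup assms(2,1)] assms
  by (simp add: pre_tensor_minus) (simp add: pre_tensor_simps)

text \<open>Congruences modulo the relations between additive maps on \<open>P\<close> need only be checked on
  generators: this is applied to differences of two such maps.\<close>

lemma frag_extend_mem_relations:
  assumes "\<And>p. p \<in> S \<Longrightarrow> u p \<in> R" and x: "Poly_Mapping.keys x \<subseteq> S"
  shows "frag_extend u x \<in> R"
  by (rule free_Abelian_group_induct[of x S "\<lambda>x. frag_extend u x \<in> R", OF x])
    (use assms(1) in \<open>auto simp: relations_zero frag_extend_diff intro: relations_diff\<close>)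

end

lemma frag_extend_plus:
  "frag_extend (\<lambda>p. u p + v p) x = frag_extend u x + frag_extend v x"
  by (rule frag_induction[of x UNIV]) (auto simp: frag_extend_diff)

lemma frag_extend_minus_fun:
  "frag_extend (\<lambda>p. u p - v p) x = frag_extend u x - frag_extend v x"
  by (rule frag_induction[of x UNIV]) (auto simp: frag_extend_diff)

lemma frag_extend_ident: "frag_extend (\<lambda>(x, b). frag_of (x, b)) z = z"
  by (simp only: case_prod_eta[of frag_of] frag_expansion[of z, symmetric])

lemma frag_extend_comp:
  "frag_extend u (frag_extend v x) = frag_extend (\<lambda>p. frag_extend u (v p)) x"
  by (rule frag_induction[of x UNIV]) (auto simp: frag_extend_diff)

text \<open>An additive map carries one relation subgroup into another as soon as it does so for the
  generating relators, because the image of a generated subgroup is generated by the images.\<close>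

lemma frag_extend_relations:
  assumes "base_change A K" "base_change B L"
    and u: "\<And>p. p \<in> carrier A \<times> carrier K \<Longrightarrow>
             Poly_Mapping.keys (u p) \<subseteq> carrier B \<times> carrier L"
    and rel: "\<And>r. r \<in> base_change.relators A K \<Longrightarrow> frag_extend u r \<in> tensor_relations B L"
    and x: "x \<in> tensor_relations A K"
  shows "frag_extend u x \<in> tensor_relations B L"
proof -
  interpret A: base_change A K by fact
  interpret B: base_change B L by fact
  have hom: "frag_extend u \<in> hom A.F B.F"
  proof (rule homI)
    fix x assume "x \<in> carrier A.F"
    then show "frag_extend u x \<in> carrier B.F"
      using u unfolding carrier_free_Abelian_group_iff by (intro keys_frag_extend_subset) blast
  qed (simp add: frag_extend_add)
  interpret h: group_hom A.F B.F "frag_extend u"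
    using hom by (simp add: group_hom_def group_hom_axioms_def)
  have "frag_extend u ` A.R = generate B.F (frag_extend u ` A.relators)"
    unfolding A.relations_eq by (rule h.generate_img[OF A.relators_subset, symmetric])
  also have "\<dots> \<subseteq> B.R"
    using rel by (intro h.H.generate_subgroup_incl B.relations_subgroup) auto
  finally show ?thesis using x by auto
qed

context base_change
begin

lemma scale_relations:
  assumes a: "a \<in> carrier K" and x: "x \<in> R"
  shows "a \<odot>\<^bsub>P\<^esub> x \<in> R"
  unfolding pre_tensor_simps
proof (rule frag_extend_relations[OF base_change_axioms base_change_axioms _ _ x])
  fix r assume "r \<in> relators"
  then show "frag_extend (\<lambda>(x, b). frag_of (x, a \<otimes>\<^bsub>K\<^esub> b)) r \<in> R"
    using a by (auto simp: relators_def frag_extend_diff K.r_distr relations_left relations_right)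
qed (use a in \<open>auto simp: keys_frag_of\<close>)

text \<open>Each law is checked on a generator \<open>(x, c)\<close>. There the law for \<open>a + b\<close> is an instance of
  additivity in the second factor, while those for \<open>a b\<close> and \<open>1\<close> come from the ring laws in \<open>K\<close> and
  hold exactly in \<open>P\<close>.\<close>

lemma tensor_module_modulo: "module_modulo K R P"
proof -
  interpret R: abelian_subgroup R P by (rule relations_abelian_subgroup)
  have closed: "a \<odot>\<^bsub>P\<^esub> x \<in> carrier P" if "a \<in> carrier K" "x \<in> carrier P" for a x
    unfolding pre_tensor_simps mem_Collect_eq
    by (rule keys_frag_extend_subset) (use that in \<open>auto simp: pre_tensor_simps(1) keys_frag_of\<close>)
  show ?thesis
  proof unfold_locales
    fix a b x assume ab: "a \<in> carrier K" "b \<in> carrier K" and x: "x \<in> carrier P"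
    have "(a \<oplus>\<^bsub>K\<^esub> b) \<odot>\<^bsub>P\<^esub> x - (a \<odot>\<^bsub>P\<^esub> x + b \<odot>\<^bsub>P\<^esub> x) \<in> R"
      unfolding pre_tensor_simps frag_extend_plus[symmetric] frag_extend_minus_fun[symmetric]
      using x ab relations_right
      by (intro frag_extend_mem_relations[of "carrier A \<times> carrier K"])
        (auto simp: pre_tensor_simps K.l_distr diff_diff_eq[symmetric])
    then show "(a \<oplus>\<^bsub>K\<^esub> b) \<odot>\<^bsub>P\<^esub> x \<in> R +>\<^bsub>P\<^esub> (a \<odot>\<^bsub>P\<^esub> x \<oplus>\<^bsub>P\<^esub> b \<odot>\<^bsub>P\<^esub> x)"
      using ab x closed R.a_closed by (subst coset_iff) (auto simp: pre_tensor_simps(3))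
    have "(a \<otimes>\<^bsub>K\<^esub> b) \<odot>\<^bsub>P\<^esub> x - a \<odot>\<^bsub>P\<^esub> (b \<odot>\<^bsub>P\<^esub> x) \<in> R"
      unfolding pre_tensor_simps frag_extend_comp frag_extend_minus_fun[symmetric]
      using x ab
      by (intro frag_extend_mem_relations[of "carrier A \<times> carrier K"])
        (auto simp: pre_tensor_simps K.m_assoc relations_zero)
    then show "(a \<otimes>\<^bsub>K\<^esub> b) \<odot>\<^bsub>P\<^esub> x \<in> R +>\<^bsub>P\<^esub> (a \<odot>\<^bsub>P\<^esub> (b \<odot>\<^bsub>P\<^esub> x))"
      using ab x closed by (subst coset_iff) auto
  next
    fix x assume x: "x \<in> carrier P"
    \<comment> \<open>the identity is written as an additive extension, so that generators suffice\<close>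
    have "\<one>\<^bsub>K\<^esub> \<odot>\<^bsub>P\<^esub> x - frag_extend (\<lambda>(x, b). frag_of (x, b)) x \<in> R"
      unfolding pre_tensor_simps frag_extend_minus_fun[symmetric]
      using x
      by (intro frag_extend_mem_relations[of "carrier A \<times> carrier K"])
        (auto simp: pre_tensor_simps relations_zero)
    then show "\<one>\<^bsub>K\<^esub> \<odot>\<^bsub>P\<^esub> x \<in> R +>\<^bsub>P\<^esub> x"
      using x closed by (subst coset_iff) (auto simp: frag_extend_ident)
  qed (use closed scale_relations in \<open>auto simp: pre_tensor_simps(3,4) frag_extend_add\<close>)
qed

lemma tensor_is_module: "module K (tensor A K)"
  unfolding tensor_def
  by (rule module_modulo.quotient_is_module[OF tensor_module_modulo])

end

text \<open>On pairs, \<open>f \<otimes> id\<close> is \<open>(x, b) \<mapsto> (f x, b)\<close>. It respects the relations because \<open>f\<close> is a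
  homomorphism, and it commutes with scalars because these act on the other factor.\<close>

lemma tensor_map_coset:
  assumes A: "base_change A K" and B: "base_change B K" and f: "f \<in> hom A B"
  shows "mod_hom K (tensor A K) (tensor B K) (tensor_map B K f)"
    and "x \<in> carrier (pre_tensor A K) \<Longrightarrow>
      tensor_map B K f (tensor_relations A K +>\<^bsub>pre_tensor A K\<^esub> x) =
      tensor_relations B K +>\<^bsub>pre_tensor B K\<^esub> frag_extend (\<lambda>(x, b). frag_of (f x, b)) x"
    and "x \<in> carrier (pre_tensor A K) \<Longrightarrow>
      frag_extend (\<lambda>(x, b). frag_of (f x, b)) x \<in> carrier (pre_tensor B K)"
proof -
  interpret A: base_change A K by fact
  interpret B: base_change B K by fact
  let ?f = "frag_extend (\<lambda>(x, b). frag_of (f x, b))"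
  have fc: "f x \<in> carrier B" if "x \<in> carrier A" for x
    using f that by (auto simp: hom_def)
  have closed: "?f x \<in> carrier B.P" if "x \<in> carrier A.P" for x
    unfolding B.pre_tensor_simps mem_Collect_eq
    by (rule keys_frag_extend_subset)
      (use that fc in \<open>auto simp: A.pre_tensor_simps(1) keys_frag_of\<close>)
  have add: "?f (x \<oplus>\<^bsub>A.P\<^esub> y) = ?f x \<oplus>\<^bsub>B.P\<^esub> ?f y" for x y
    by (simp add: A.pre_tensor_simps B.pre_tensor_simps frag_extend_add)
  have scale: "?f (a \<odot>\<^bsub>A.P\<^esub> x) = a \<odot>\<^bsub>B.P\<^esub> ?f x" for a x
    unfolding A.pre_tensor_simps B.pre_tensor_simps frag_extend_comp by (simp add: case_prod_beta)
  have "?f x \<in> B.R" if "x \<in> A.R" for x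
  proof (rule frag_extend_relations[OF A B _ _ that])
    fix r assume "r \<in> A.relators"
    then show "?f r \<in> B.R"
      using f fc by (auto simp: A.relators_def frag_extend_diff hom_mult
          B.relations_left B.relations_right)
  qed (use fc in \<open>auto simp: keys_frag_of\<close>)
  then have img: "?f ` A.R \<subseteq> B.R" by auto
  have eq: "tensor_map B K f = (\<lambda>X. B.R <+>\<^bsub>B.P\<^esub> ?f ` X)"
    by (simp add: tensor_map_def fun_eq_iff)
  show "mod_hom K (tensor A K) (tensor B K) (tensor_map B K f)"
    unfolding eq tensor_def
    by (rule induced_map_is_mod_hom[OF A.tensor_module_modulo B.tensor_module_modulo])
      (use closed add scale img in auto)
  assume x: "x \<in> carrier A.P"
  show "tensor_map B K f (A.R +>\<^bsub>A.P\<^esub> x) = B.R +>\<^bsub>B.P\<^esub> ?f x"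
    unfolding eq
    by (rule coset_image_eq[OF A.relations_abelian_subgroup B.relations_abelian_subgroup
        _ _ img x]) (use closed add in auto)
  show "?f x \<in> carrier B.P" by (rule closed[OF x])
qed

text \<open>The composite sends a generator \<open>(x, b)\<close> to \<open>(g (f x), b)\<close>, which is \<open>0 \<otimes> b = 0\<close>.\<close>

lemma tensor_map_comp_zero:
  assumes A: "base_change A K" and B: "base_change B K" and C: "base_change C K"
    and f: "f \<in> hom A B" and g: "g \<in> hom B C"
    and gf: "\<And>x. x \<in> carrier A \<Longrightarrow> g (f x) = \<one>\<^bsub>C\<^esub>"
    and X: "X \<in> carrier (tensor A K)"
  shows "tensor_map C K g (tensor_map B K f X) = \<zero>\<^bsub>tensor C K\<^esub>"
proof -
  interpret A: base_change A K by fact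
  interpret C: base_change C K by fact
  interpret MA: module_modulo K A.R A.P by (rule A.tensor_module_modulo)
  interpret MC: module_modulo K C.R C.P by (rule C.tensor_module_modulo)
  obtain x where x: "x \<in> carrier A.P" "X = A.R +>\<^bsub>A.P\<^esub> x"
    using X by (auto simp: tensor_def MA.quotient_carrier)
  let ?f = "frag_extend (\<lambda>(x, b). frag_of (f x, b))"
  let ?g = "frag_extend (\<lambda>(x, b). frag_of (g x, b))"
  have "?g (?f x) \<in> C.R"
    unfolding frag_extend_comp
    by (rule C.frag_extend_mem_relations[of "carrier A \<times> carrier K"])
      (use x gf C.relations_one in \<open>auto simp: A.pre_tensor_simps\<close>)
  then have "C.R +>\<^bsub>C.P\<^esub> ?g (?f x) = C.R"
    by (rule MC.a_rcos_const)
  then show ?thesis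
    using x tensor_map_coset(2,3)[OF A B f x(1)] tensor_map_coset(2)[OF B C g]
    by (simp add: tensor_def MC.quotient_zero)
qed

lemma base_change_free_group: "cring K \<Longrightarrow> base_change (free_Abelian_group S) K"
  by (simp add: base_change_def)

text \<open>The vectors \<open>s \<otimes> 1\<close> with \<open>s \<in> S\<close> span: any \<open>y \<otimes> b\<close> with \<open>y\<close> in the free group reduces by
  additivity in \<open>y\<close> to terms \<open>s \<otimes> b = b \<cdot> (s \<otimes> 1)\<close>. Spanning gives finite dimension and the
  upper bound on it; the bound makes chain spaces in degrees without cells vanish.\<close>

lemma tensor_free_spanned:
  assumes "field K" and S: "finite S"
  shows "vectorspace.fin_dim K (tensor (free_Abelian_group S) K)"
    and "vectorspace.dim K (tensor (free_Abelian_group S) K) \<le> card S"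
proof -
  let ?A = "free_Abelian_group S"
  let ?T = "tensor ?A K"
  interpret K: field K by fact
  interpret T: base_change ?A K
    by (rule base_change_free_group) (rule K.is_cring)
  interpret V: vectorspace K ?T
    using T.tensor_is_module by (intro vectorspace_if_module) (rule assms(1))
  interpret Q: module_modulo K T.R T.P by (rule T.tensor_module_modulo)
  let ?c = "\<lambda>x. T.R +>\<^bsub>T.P\<^esub> x"
  let ?G = "(\<lambda>s. ?c (frag_of (frag_of s, \<one>\<^bsub>K\<^esub>))) ` S"
  have c_carrier: "?c x \<in> carrier ?T" if "x \<in> carrier T.P" for x
    using that by (auto simp: tensor_def Q.quotient_carrier)
  have pair: "frag_of (x, b) \<in> carrier T.P" if "x \<in> carrier ?A" "b \<in> carrier K" for x b
    using that by (simp add: T.pre_tensor_simps keys_frag_of)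
  have G: "?G \<subseteq> carrier ?T"
    using c_carrier pair by auto
  interpret U: submodule K "V.span ?G" ?T
    using G by (rule V.span_is_submodule)
  \<comment> \<open>the span is pulled back to the free group on pairs, where induction on generators is possible\<close>
  let ?U = "{x \<in> carrier T.P. ?c x \<in> V.span ?G}"
  have U_diff: "x - y \<in> ?U" if "x \<in> ?U" "y \<in> ?U" for x y
  proof -
    have P: "x \<in> carrier T.P" "y \<in> carrier T.P" using that by auto
    then have xy: "x - y \<in> carrier T.P"
      by (auto simp: T.pre_tensor_simps dest!: subsetD[OF keys_diff])
    have "?c x = ?c (x - y) \<oplus>\<^bsub>?T\<^esub> ?c y"
      using Q.quotient_add[OF xy P(2)] by (simp add: tensor_def T.pre_tensor_simps(3))
    then have "?c (x - y) = ?c x \<oplus>\<^bsub>?T\<^esub> (\<ominus>\<^bsub>?T\<^esub> ?c y)"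
      using c_carrier P xy by (simp add: V.M.a_assoc V.M.r_neg)
    then have "?c (x - y) = ?c x \<oplus>\<^bsub>?T\<^esub> (\<ominus>\<^bsub>K\<^esub> \<one>\<^bsub>K\<^esub>) \<odot>\<^bsub>?T\<^esub> ?c y"
      using c_carrier P by (simp add: V.smult_minus_1)
    then show ?thesis using that xy by simp
  qed
  have U_scale: "a \<odot>\<^bsub>T.P\<^esub> x \<in> ?U" if "a \<in> carrier K" "x \<in> ?U" for a x
    using that Q.quotient_smult[of a x] U.smult_closed[of a "?c x"]
    by (simp add: tensor_def Q.scale_closed)
  have U_rel: "x \<in> ?U" if "x \<in> T.R" for x
    using that Q.a_rcos_const[OF that] U.zero_closed Q.a_subset
    by (auto simp: tensor_def Q.quotient_zero)
  have U_pair: "frag_of (y, b) \<in> ?U" if y: "Poly_Mapping.keys y \<subseteq> S" and b: "b \<in> carrier K" for y b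
    using y
  proof (rule free_Abelian_group_induct)
    show "frag_of (0, b) \<in> ?U"
      using U_rel T.relations_one[OF b] by simp
  next
    fix y z assume yz: "Poly_Mapping.keys y \<subseteq> S" "Poly_Mapping.keys z \<subseteq> S"
      "frag_of (y, b) \<in> ?U" "frag_of (z, b) \<in> ?U"
    have "Poly_Mapping.keys (y - z) \<subseteq> S"
      using yz keys_diff[of y z] by blast
    then have "frag_of (y, b) - frag_of (y - z, b) - frag_of (z, b) \<in> T.R"
      using yz b T.relations_left[of "y - z" z b] by simp
    \<comment> \<open>up to a relation, \<open>(y - z, b)\<close> is \<open>(y, b) - (z, b)\<close>\<close>
    from U_diff[OF U_diff[OF yz(3,4)] U_rel[OF this]] show "frag_of (y - z, b) \<in> ?U"
      by simp
  next
    fix s assume s: "s \<in> S"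
    then have "?c (frag_of (frag_of s, \<one>\<^bsub>K\<^esub>)) \<in> V.span ?G"
      using V.span_mem[OF G] by blast
    then have "b \<odot>\<^bsub>T.P\<^esub> frag_of (frag_of s, \<one>\<^bsub>K\<^esub>) \<in> ?U"
      using s pair by (intro U_scale b) auto
    then show "frag_of (frag_of s, b) \<in> ?U"
      using b by (simp add: T.pre_tensor_simps(4))
  qed
  have "x \<in> ?U" if "x \<in> carrier T.P" for x
  proof (rule free_Abelian_group_induct[of x "carrier ?A \<times> carrier K" "\<lambda>x. x \<in> ?U"])
    show "Poly_Mapping.keys x \<subseteq> carrier ?A \<times> carrier K"
      using that by (simp add: T.pre_tensor_simps)
  qed (use U_rel[OF T.relations_zero] U_pair U_diff in auto)
  then have "carrier ?T \<subseteq> V.span ?G"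
    by (auto simp: tensor_def Q.quotient_carrier)
  then have gen: "V.gen_set ?G"
    using U.subset by auto
  show "V.fin_dim"
    using gen G S by (auto simp: V.fin_dim_def)
  have "V.dim \<le> card ?G"
    using G S gen by (intro V.gen_ge_dim) auto
  then show "V.dim \<le> card S"
    using card_image_le[OF S] by (rule le_trans)
qed

section \<open>Dimensions in the base-changed complex\<close>

context finite_script_complex
begin

text \<open>With \<open>Z\<^sub>k\<close> the cycles and \<open>B\<^sub>k\<close> the boundaries, rank-nullity
  for the map leaving degree \<open>k\<close> gives \<open>c\<^sub>k = dim Z\<^sub>k + r\<^sub>k\<close>. As \<open>r\<^bsub>k+1\<^esub>\<close> is \<open>dim B\<^sub>k\<close>, the quotient
  \<open>Z\<^sub>k / B\<^sub>k\<close> gives \<open>dim Z\<^sub>k = r\<^bsub>k+1\<^esub> + \<beta>\<^sub>k\<close>.\<close>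

lemma chain_dim_eq:
  assumes K: "field K"
  shows "chain_dim cells K k = betti cells bd K k + bd_rank cells bd K (Suc k) + bd_rank cells bd K k"
proof -
  interpret K: field K by fact
  have bc: "base_change (chain_group cells j) K" for j
    by (rule base_change_free_group[OF K.is_cring])
  let ?C = "chain_space cells K" and ?d = "bd_map cells bd K"
  have vs: "vectorspace K (?C j)" for j
    unfolding chain_space_def
    by (rule vectorspace_if_module[OF K base_change.tensor_is_module[OF bc]])
  have fin: "vectorspace.fin_dim K (?C j)" for j
    unfolding chain_space_def by (rule tensor_free_spanned(1)[OF K finite_cells])
  have lin: "linear_map K (?C (Suc j)) (?C j) (?d j)" for j
    unfolding linear_map_def using vs tensor_map_coset(1)[OF bc bc bd_hom]
    by (auto simp: chain_space_def bd_map_def)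
  have zero: "?d j (?d (Suc j) X) = \<zero>\<^bsub>?C j\<^esub>" if "X \<in> carrier (?C (Suc (Suc j)))" for j X
    unfolding chain_space_def bd_map_def
    by (rule tensor_map_comp_zero[OF bc bc bc bd_hom bd_hom])
      (use that bd_bd in \<open>auto simp: chain_space_def\<close>)
  have kernel: "cycles cells bd K (Suc j) = {X \<in> carrier (?C (Suc j)). ?d j X = \<zero>\<^bsub>?C j\<^esub>}" for j
    by (simp add: a_kernel_def')
  interpret C: vectorspace K "?C k" by (rule vs)
  interpret d: linear_map K "?C (Suc k)" "?C k" "?d k" by (rule lin)
  have im: "d.imT = boundaries cells bd K k"
    by (simp add: d.im_def boundaries_def)
  have cycles: "subspace K (cycles cells bd K k) (?C k) \<and>
      C.dim = vectorspace.dim K (C.vs (cycles cells bd K k)) + bd_rank cells bd K k"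
  proof (cases k)
    case 0
    \<comment> \<open>every chain of degree 0 is a cycle, and \<open>r\<^sub>0 = 0\<close>\<close>
    have "subspace K (carrier (?C k)) (?C k)"
      unfolding subspace_def submodule_def using C.vectorspace_axioms C.module_axioms by auto
    then show ?thesis using 0 by simp
  next
    case (Suc j)
    interpret e: linear_map K "?C (Suc j)" "?C j" "?d j" by (rule lin)
    have "e.imT = boundaries cells bd K j"
      by (simp add: e.im_def boundaries_def)
    moreover have "e.kerT = cycles cells bd K (Suc j)"
      by (simp only: e.ker_def kernel)
    ultimately show ?thesis
      using e.rank_nullity[OF fin] e.kerT_is_subspace Suc by simp
  qed
  let ?Z = "C.vs (cycles cells bd K k)"
  interpret Z: vectorspace K ?Z
    using cycles by (intro C.subspace_is_vs) auto
  have finZ: "Z.fin_dim"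
    using cycles fin by (intro C.subspace_fin_dim) auto
  have sub: "boundaries cells bd K k \<subseteq> cycles cells bd K k"
  proof (cases k)
    case 0
    then show ?thesis
      using submodule.subset[OF d.im_is_submodule] unfolding im by simp
  next
    case (Suc j)
    then show ?thesis
      using submodule.subset[OF d.im_is_submodule] zero unfolding im
      by (auto simp: kernel boundaries_def simp del: cycles.simps)
  qed
  have "submodule K (boundaries cells bd K k) ?Z"
    using d.im_is_submodule sub Z.module_axioms unfolding im
    by (auto simp: submodule_def)
  then have "subspace K (boundaries cells bd K k) ?Z"
    using Z.vectorspace_axioms by (simp add: subspace_def)
  from Z.dim_quotient[OF finZ this]
  have "Z.dim = bd_rank cells bd K (Suc k) + betti cells bd K k"
    by (simp add: betti_def homology_def)
  with cycles show ?thesis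
    by (simp add: chain_dim_def)
qed

lemma chain_dim_le:
  assumes K: "field K"
  shows "chain_dim cells K k \<le> card (cells k)"
  unfolding chain_dim_def chain_space_def
  by (rule tensor_free_spanned(2)[OF K finite_cells])

end

section \<open>The polynomial identity\<close>

lemma coeff_Sum_any_monom:
  assumes "finite {k. f k \<noteq> (0 :: 'a :: comm_monoid_add)}"
  shows "coeff (Sum_any (\<lambda>k. monom (f k) k)) n = f n"
proof -
  have "{k. monom (f k) k \<noteq> 0} = {k. f k \<noteq> 0}" by simp
  then have "coeff (Sum_any (\<lambda>k. monom (f k) k)) n = (\<Sum>k | f k \<noteq> 0. if k = n then f k else 0)"
    by (simp add: Sum_any.expand_set coeff_sum)
  also have "\<dots> = f n"
    using assms by (simp add: sum.delta')
  finally show ?thesis .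
qed

theorem theorem3p1:
  fixes cells :: "nat \<Rightarrow> 'c set"
    and bd :: "nat \<Rightarrow> ('c \<Rightarrow>\<^sub>0 int) \<Rightarrow> ('c \<Rightarrow>\<^sub>0 int)"
    and K :: "('k, 'm) ring_scheme"
  assumes "finite_script_complex cells bd"
    and "field K"
  shows "cell_poly cells K =
           poincare_poly cells bd K + [:1, 1:] * boundary_poly cells bd K
         \<and> [:1, 1:] dvd (cell_poly cells K - poincare_poly cells bd K)
         \<and> (\<forall>k. 0 \<le> coeff ((cell_poly cells K - poincare_poly cells bd K) div [:1, 1:]) k)"
proof -
  interpret finite_script_complex cells bd by fact
  note rank = chain_dim_eq[OF assms(2)]
  obtain n where n: "\<And>k. k > n \<Longrightarrow> cells k = {}"
    using bounded_dimension by blast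
  have vanish: "chain_dim cells K k = 0" if "k > n" for k
    using chain_dim_le[OF assms(2), of k] n[OF that] by simp
  \<comment> \<open>finiteness matters: without it the sums defining the polynomials would be 0 by convention\<close>
  have fin: "finite {k. f k \<noteq> 0}" if "\<And>k. f k \<le> int (chain_dim cells K k)" "\<And>k. 0 \<le> f k" for f
  proof (rule finite_subset)
    show "{k. f k \<noteq> 0} \<subseteq> {..n}"
    proof
      fix k assume "k \<in> {k. f k \<noteq> 0}"
      then have "chain_dim cells K k \<noteq> 0"
        using that[of k] by auto
      then show "k \<in> {..n}"
        using vanish[of k] by (cases "k > n") auto
    qed
  qed simp
  have M: "coeff (cell_poly cells K) k = int (chain_dim cells K k)" for k
    unfolding cell_poly_def by (intro coeff_Sum_any_monom fin) auto
  have P: "coeff (poincare_poly cells bd K) k = int (betti cells bd K k)" for k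
    unfolding poincare_poly_def by (intro coeff_Sum_any_monom fin) (simp_all add: rank)
  have B: "coeff (boundary_poly cells bd K) k = int (bd_rank cells bd K (Suc k))" for k
    unfolding boundary_poly_def by (intro coeff_Sum_any_monom fin) (simp_all add: rank)
  have eq: "cell_poly cells K =
      poincare_poly cells bd K + [:1, 1:] * boundary_poly cells bd K"
  proof (rule poly_eqI)
    fix k
    \<comment> \<open>multiplication by \<open>1 + t\<close> contributes \<open>r\<^bsub>k+1\<^esub> + r\<^sub>k\<close> in degree \<open>k\<close>, where \<open>r\<^sub>0 = 0\<close>\<close>
    show "coeff (cell_poly cells K) k =
        coeff (poincare_poly cells bd K + [:1, 1:] * boundary_poly cells bd K) k"
      by (cases k) (simp_all add: M P B rank coeff_pCons del: bd_rank.simps(2))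
  qed
  then have diff: "cell_poly cells K - poincare_poly cells bd K =
      [:1, 1:] * boundary_poly cells bd K"
    by simp
  have "[:1, 1:] * boundary_poly cells bd K div [:1, 1:] = boundary_poly cells bd K"
    by (rule nonzero_mult_div_cancel_left) simp
  then have "\<forall>k. 0 \<le> coeff ((cell_poly cells K - poincare_poly cells bd K) div [:1, 1:]) k"
    unfolding diff by (simp only: B) simp
  then show ?thesis
    using eq diff dvd_triv_left by metis
qed

end
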